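(* Let $(\frac pq,\frac rs)$ be a Farey pair of order $n$ with $0<\frac pq$, $\frac rs<1$ and $q<s$. Let $d=\lfloor n/q\rfloor$ and, for $\alpha\in[0,1]$, $\beta=1-\alpha$, let $\phi_\alpha(t)=(t^q-\beta)^d-\alpha^dt^{qd-s}$. Let $\theta\in\arg(q,s)$, let $t=\rho e^{i\theta}$ be the point of $\partial\Theta_n$ with argument $\theta$, and let $\alpha(\theta)\in[0,1]$ be such that $t$ is a root of $\phi_{\alpha(\theta)}$. Then $t$ is a subdominant root of $\phi_{\alpha(\theta)}$.
   Context: A matrix is stochastic if it is entrywise nonnegative with all row sums $1$; $\Theta_n$ is the set of all eigenvalues of all $n\times n$ stochastic matrices and $\partial\Theta_n$ its boundary. $\mathcal{F}_n=\{p/q:0\le p<q\le n,\ \gcd(p,q)=1\}$; a Farey pair of order $n$ is a pair $(\frac pq,\frac rs)$ of elements of $\mathcal F_n$ with $\frac pq<\frac rs$ and no element of $\mathcal F_n$ strictly between them. $\arg(q,s)=(\frac{2\pi p}{q},\frac{2\pi r}{s})\cup(\frac{2\pi(s-r)}{s},\frac{2\pi(q-p)}{q})$, arguments in $[0,2\pi)$. The number $1$ is always a root of $\phi_\alpha$ of maximum modulus; a root $z$ of $\phi_\alpha$ is called subdominant if its modulus is the next largest after that of $1$, i.e. $|z|=\max\{|w|: w\ne 1,\ \phi_\alpha(w)=0\}$. *)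

theory Defs
  imports "HOL-Analysis.Analysis"
begin

text \<open>n x n real matrices are represented as functions nat => nat => real,
  only the entries with indices < n being relevant.\<close>

definition stochastic :: "nat \<Rightarrow> (nat \<Rightarrow> nat \<Rightarrow> real) \<Rightarrow> bool" where
  "stochastic n A \<longleftrightarrow>
     (\<forall>i<n. \<forall>j<n. 0 \<le> A i j) \<and> (\<forall>i<n. (\<Sum>j<n. A i j) = 1)"

definition is_eigenvalue :: "nat \<Rightarrow> (nat \<Rightarrow> nat \<Rightarrow> real) \<Rightarrow> complex \<Rightarrow> bool" where
  "is_eigenvalue n A \<mu> \<longleftrightarrow>
     (\<exists>v :: nat \<Rightarrow> complex. (\<exists>i<n. v i \<noteq> 0) \<and>
        (\<forall>i<n. (\<Sum>j<n. complex_of_real (A i j) * v j) = \<mu> * v i))"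

definition Theta :: "nat \<Rightarrow> complex set" where
  "Theta n = {\<mu>. \<exists>A. stochastic n A \<and> is_eigenvalue n A \<mu>}"

definition farey :: "nat \<Rightarrow> (nat \<times> nat) set" where
  "farey n = {(p, q). p < q \<and> q \<le> n \<and> coprime p q}"

definition farey_pair :: "nat \<Rightarrow> nat \<Rightarrow> nat \<Rightarrow> nat \<Rightarrow> nat \<Rightarrow> bool" where
  "farey_pair n p q r s \<longleftrightarrow>
     (p, q) \<in> farey n \<and> (r, s) \<in> farey n \<and>
     real p / real q < real r / real s \<and>
     \<not> (\<exists>(a, b) \<in> farey n. real p / real q < real a / real b \<and>
                              real a / real b < real r / real s)"

definition arg_set :: "nat \<Rightarrow> nat \<Rightarrow> nat \<Rightarrow> nat \<Rightarrow> real set" where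
  "arg_set p q r s =
     {2 * pi * real p / real q <..< 2 * pi * real r / real s} \<union>
     {2 * pi * (real s - real r) / real s <..< 2 * pi * (real q - real p) / real q}"

text \<open>phi_alpha(t) = (t^q - beta)^d - alpha^d t^(qd - s), beta = 1 - alpha;
  the exponent qd - s is an integer (possibly negative), hence powi.\<close>
definition phi :: "nat \<Rightarrow> nat \<Rightarrow> nat \<Rightarrow> real \<Rightarrow> complex \<Rightarrow> complex" where
  "phi q s d \<alpha> t =
     (t ^ q - complex_of_real (1 - \<alpha>)) ^ d
       - complex_of_real \<alpha> ^ d * t powi (int q * int d - int s)"

definition subdominant_root :: "(complex \<Rightarrow> complex) \<Rightarrow> complex \<Rightarrow> bool" where
  "subdominant_root f z \<longleftrightarrow>
     f z = 0 \<and>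
     (\<exists>w. w \<noteq> 1 \<and> f w = 0 \<and> cmod w = cmod z) \<and>
     (\<forall>w. w \<noteq> 1 \<and> f w = 0 \<longrightarrow> cmod w \<le> cmod z)"

end

theory Submission
  imports Defs
begin

text \<open>
  A root \<open>w\<close> of \<open>\<phi>\<^sub>\<alpha>\<close> satisfies \<open>A + B = 1\<close> with \<open>A = \<beta> / w\<^sup>q\<close> and \<open>B\<^sup>d = \<alpha>\<^sup>d / w\<^sup>s\<close>, that is, it
  gives a triangle with a side of length \<open>1\<close>, adjacent sides \<open>a = \<beta> |w|\<^bsup>-q\<^esup>\<close>, \<open>b = \<alpha> |w|\<^bsup>-s/d\<^esup>\<close> and
  base angles \<open>X\<close>, \<open>Y\<close> for which \<open>s X + q d Y = 2\<pi>m\<close> with an integer \<open>m \<ge> 0\<close>; only \<open>w = 1\<close> has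
  \<open>m = 0\<close>. The map \<open>(X, Y) \<mapsto> (ln b, ln a)\<close> is strictly monotone, so a larger \<open>|w|\<close> forces a smaller
  \<open>m\<close>, and every root with \<open>m = 1\<close> is subdominant. For \<open>t\<close> one has \<open>m = 1 + q k\<close>, \<open>k \<ge> 0\<close>. If \<open>k > 0\<close>,
  then on all rays close to that of \<open>t\<close> there are points with \<open>k = 0\<close> further out; these are
  eigenvalues of explicit stochastic matrices, and since the region is starlike, \<open>t\<close> would be an
  interior point. Hence a boundary point has \<open>k = 0\<close>.
\<close>

section \<open>Triangles with a side of length one\<close>

lemma quadratic_form_pos:
  fixes u v c :: real
  assumes "\<bar>c\<bar> < 1" "u \<noteq> 0 \<or> v \<noteq> 0"
  shows "0 < u\<^sup>2 + v\<^sup>2 - 2 * c * u * v"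
proof -
  have eq: "u\<^sup>2 + v\<^sup>2 - 2 * c * u * v = (u - c * v)\<^sup>2 + (1 - c\<^sup>2) * v\<^sup>2"
    by (simp add: power2_eq_square algebra_simps)
  have c: "0 < 1 - c\<^sup>2"
    using assms(1) by (simp add: abs_square_less_1)
  show ?thesis
  proof (cases "v = 0")
    case True
    then show ?thesis using assms(2) by simp
  next
    case False
    then have "0 < (1 - c\<^sup>2) * v\<^sup>2" using c by simp
    then show ?thesis unfolding eq by (simp add: add_nonneg_pos)
  qed
qed

text \<open>Clearing denominators with \<open>sin X * sin Y * sin (X + Y)\<close> and using
  \<open>cos X * sin (X + Y) - cos (X + Y) * sin X = sin Y\<close> and its mirror image leaves
  \<open>U^2 + V^2 - 2 * cos (X + Y) * U * V\<close> with \<open>U = u * sin Y\<close>,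
  \<open>V = v * sin X\<close>.\<close>

lemma triangle_form_pos:
  fixes u v X Y :: real
  assumes "0 < X" "0 < Y" "X + Y < pi" "u \<noteq> 0 \<or> v \<noteq> 0"
  shows "0 < u * (u * (cos X / sin X) - (u + v) * (cos (X + Y) / sin (X + Y))) +
             v * (v * (cos Y / sin Y) - (u + v) * (cos (X + Y) / sin (X + Y)))"
    (is "0 < ?L")
proof -
  have sX: "sin X > 0" and sY: "sin Y > 0" and sS: "sin (X + Y) > 0"
    using assms by (auto intro!: sin_gt_zero)
  have "\<bar>cos (X + Y)\<bar> < 1"
  proof -
    have "(cos (X + Y))\<^sup>2 < 1"
      using sS sin_cos_squared_add[of "X + Y"] by (smt (verit) zero_less_power)
    then show ?thesis by (simp add: abs_square_less_1)
  qed
  then have pos: "0 < (u * sin Y)\<^sup>2 + (v * sin X)\<^sup>2 - 2 * cos (X + Y) * (u * sin Y) * (v * sin X)"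
    using assms(4) sX sY by (intro quadratic_form_pos) auto
  have e1: "cos X * sin (X + Y) - cos (X + Y) * sin X = sin Y"
    using sin_diff[of "X + Y" X] by (simp add: mult.commute)
  have e2: "cos Y * sin (X + Y) - cos (X + Y) * sin Y = sin X"
    using sin_diff[of "X + Y" Y] by (simp add: mult.commute)
  have "?L * (sin X * sin Y * sin (X + Y)) =
      u\<^sup>2 * sin Y * (cos X * sin (X + Y) - cos (X + Y) * sin X)
      + v\<^sup>2 * sin X * (cos Y * sin (X + Y) - cos (X + Y) * sin Y)
      - 2 * cos (X + Y) * (u * sin Y) * (v * sin X)"
    using sX sY sS by (simp add: field_simps power2_eq_square)
  also have "\<dots> = (u * sin Y)\<^sup>2 + (v * sin X)\<^sup>2 - 2 * cos (X + Y) * (u * sin Y) * (v * sin X)"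
    unfolding e1 e2 by (simp add: power2_eq_square algebra_simps)
  finally have "0 < ?L * (sin X * sin Y * sin (X + Y))" using pos by simp
  moreover have "0 < sin X * sin Y * sin (X + Y)" using sX sY sS by simp
  ultimately show ?thesis by (rule zero_less_mult_pos2)
qed

text \<open>By the law of sines the sides adjacent to the base angles \<open>X\<close> and \<open>Y\<close> are
  \<open>a = sin Y / sin (X + Y)\<close> and \<open>b = sin X / sin (X + Y)\<close>. Monotonicity holds
  because the Jacobian of \<open>(X, Y) \<mapsto> (ln b, ln a)\<close> is symmetric and positive definite.\<close>

lemma triangle_angles_monotone:
  fixes X0 Y0 X1 Y1 :: real
  assumes P0: "0 < X0" "0 < Y0" "X0 + Y0 < pi"
    and P1: "0 < X1" "0 < Y1" "X1 + Y1 < pi"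
    and ne: "X1 \<noteq> X0 \<or> Y1 \<noteq> Y0"
  shows "0 < (X1 - X0) * (ln (sin X1 / sin (X1 + Y1)) - ln (sin X0 / sin (X0 + Y0))) +
             (Y1 - Y0) * (ln (sin Y1 / sin (X1 + Y1)) - ln (sin Y0 / sin (X0 + Y0)))"
proof -
  define u v where "u = X1 - X0" and "v = Y1 - Y0"
  define X Y where "X = (\<lambda>h. X0 + h * u)" and "Y = (\<lambda>h. Y0 + h * v)"
  \<comment> \<open>Up to \<open>ln_div\<close>, \<open>f 1 - f 0\<close> is the claimed quantity:
    the direction \<open>(u, v)\<close> paired with the logarithms of the sides along the segment of
    angles. The derivative of \<open>f\<close> is the form of
    \<open>triangle_form_pos\<close>.\<close>
  define f where "f = (\<lambda>h. u * (ln (sin (X h)) - ln (sin (X h + Y h))) +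
                           v * (ln (sin (Y h)) - ln (sin (X h + Y h))))"
  have dom: "0 < X h" "0 < Y h" "X h + Y h < pi" if "0 \<le> h" "h \<le> 1" for h
  proof -
    have *: "(1 - h) * c0 + h * c1 < c" if "c0 < c" "c1 < c" for c0 c1 c
      using \<open>0 \<le> h\<close> \<open>h \<le> 1\<close> that by (intro convex_bound_lt) auto
    have "X h = (1 - h) * X0 + h * X1" "Y h = (1 - h) * Y0 + h * Y1"
      by (simp_all add: X_def Y_def u_def v_def algebra_simps)
    then show "0 < X h" "0 < Y h" "X h + Y h < pi"
      using *[of "- X0" 0 "- X1"] *[of "- Y0" 0 "- Y1"] *[of "X0 + Y0" pi "X1 + Y1"] P0 P1
      by (auto simp: algebra_simps)
  qed
  have "f 0 < f 1"
  proof (rule DERIV_pos_imp_increasing[of 0 1 f])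
    fix h :: real assume h: "0 \<le> h" "h \<le> 1"
    note D = dom[OF h]
    have s: "sin (X h) > 0" "sin (Y h) > 0" "sin (X h + Y h) > 0"
      using D by (auto intro!: sin_gt_zero)
    have "(f has_real_derivative
        u * (u * (cos (X h) / sin (X h)) - (u + v) * (cos (X h + Y h) / sin (X h + Y h))) +
        v * (v * (cos (Y h) / sin (Y h)) - (u + v) * (cos (X h + Y h) / sin (X h + Y h)))) (at h)"
      using s unfolding f_def X_def Y_def
      by (auto intro!: derivative_eq_intros simp: field_simps)
    moreover have "u \<noteq> 0 \<or> v \<noteq> 0" using ne by (auto simp: u_def v_def)
    ultimately show "\<exists>y. (f has_real_derivative y) (at h) \<and> 0 < y"
      using triangle_form_pos[OF D] by blast
  qed simp
  moreover have "sin X0 > 0" "sin Y0 > 0" "sin (X0 + Y0) > 0" "sin X1 > 0" "sin Y1 > 0"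
      "sin (X1 + Y1) > 0"
    using P0 P1 by (auto intro!: sin_gt_zero)
  ultimately show ?thesis
    by (simp add: f_def X_def Y_def u_def v_def ln_div algebra_simps)
qed

lemma sin_over_arg_strict_decreasing:
  fixes x y :: real
  assumes "0 < x" "x < y" "y < pi"
  shows "sin y / y < sin x / x"
proof (rule DERIV_neg_imp_decreasing[OF assms(2)])
  fix h assume h: "x \<le> h" "h \<le> y"
  have "h * cos h - sin h < 0 * cos 0 - sin (0::real)"
  proof (rule DERIV_neg_imp_decreasing_open[of 0 h "\<lambda>h. h * cos h - sin h"])
    fix z :: real assume z: "0 < z" "z < h"
    have "((\<lambda>h. h * cos h - sin h) has_real_derivative - (z * sin z)) (at z)"
      by (auto intro!: derivative_eq_intros)
    moreover have "sin z > 0" using z h assms by (intro sin_gt_zero) auto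
    ultimately show "\<exists>y. ((\<lambda>h. h * cos h - sin h) has_real_derivative y) (at z) \<and> y < 0"
      using z by (intro exI[of _ "- (z * sin z)"]) auto
  qed (use h assms in \<open>auto intro!: continuous_intros\<close>)
  then have "(h * cos h - sin h) / (h * h) < 0"
    using h assms by (simp add: divide_neg_pos)
  moreover have "((\<lambda>h. sin h / h) has_real_derivative (h * cos h - sin h) / (h * h)) (at h)"
    using h assms by (auto intro!: derivative_eq_intros simp: field_simps)
  ultimately show "\<exists>z. ((\<lambda>h. sin h / h) has_real_derivative z) (at h) \<and> z < 0" by blast
qed

text \<open>Gibbs' inequality for the weights \<open>X / (X + Z)\<close> and
  \<open>Z / (X + Z)\<close>, scaled by \<open>X + Z\<close>; it comes from
  \<open>ln x \<le> x - 1\<close> applied to each term.\<close>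

lemma gibbs_two:
  fixes X Z u :: real
  assumes "0 < X" "0 < Z" "0 < u" "u < 1"
  shows "X * ln u + Z * ln (1 - u) \<le> X * ln (X / (X + Z)) + Z * ln (Z / (X + Z))"
proof -
  have bd: "C * (ln w - ln (C / (X + Z))) \<le> w * (X + Z) - C" if "0 < C" "0 < w" for C w
  proof -
    have "ln w - ln (C / (X + Z)) = ln (w * (X + Z) / C)"
      using that assms by (simp add: ln_div ln_mult)
    also have "\<dots> \<le> w * (X + Z) / C - 1"
      using that assms by (intro ln_le_minus_one) auto
    finally have "C * (ln w - ln (C / (X + Z))) \<le> C * (w * (X + Z) / C - 1)"
      using that by (intro mult_left_mono) auto
    also have "\<dots> = w * (X + Z) - C" using that by (simp add: field_simps)
    finally show ?thesis .
  qed
  show ?thesis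
    using bd[of X u] bd[of Z "1 - u"] assms by (simp add: algebra_simps)
qed

text \<open>The analogue of monotonicity when the second triangle collapses to base angles \<open>0\<close> and
  \<open>\<pi>\<close>, where the sides are no longer determined by the angles.\<close>

lemma collapsed_triangle_monotone:
  fixes X Y a b :: real
  assumes P: "0 < X" "0 < Y" "X + Y < pi" and ab: "0 < b" "a = 1 + b"
  shows "0 < (0 - X) * (ln b - ln (sin X / sin (X + Y))) +
             (pi - Y) * (ln a - ln (sin Y / sin (X + Y)))"
proof -
  define Z where "Z = pi - X - Y"
  define T where "T = X + Z"
  have Z: "0 < Z" "T = pi - Y" "X < T" "Z < T" "T < pi" "X + Y = pi - Z" "0 < T"
    using P by (auto simp: Z_def T_def)
  have s: "sin X > 0" "sin Z > 0" "sin T > 0"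
    using P Z by (auto intro!: sin_gt_zero)
  have sYT: "sin Y = sin T" "sin (X + Y) = sin Z" by (simp_all add: Z)
  have a: "a > 0" using ab by simp
  have lt: "ln (C / T) < ln (sin C / sin T)" if "0 < C" "C < T" for C
  proof -
    have "C / T < sin C / sin T"
      using sin_over_arg_strict_decreasing[of C T] that Z(5,7) s(3) by (simp add: field_simps)
    moreover have "0 < sin C" using that Z by (intro sin_gt_zero) auto
    ultimately show ?thesis using that Z(7) s(3) by (subst ln_less_cancel_iff) auto
  qed
  \<comment> \<open>Since \<open>a = 1 + b\<close>, the numbers \<open>b / a\<close> and
    \<open>1 / a\<close> add up to \<open>1\<close>. Gibbs' inequality replaces them by the ratios
    of the angles \<open>X\<close>, \<open>Z\<close> to \<open>T\<close>, and these lie below the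
    corresponding ratios of sines because \<open>sin h / h\<close> decreases.\<close>
  have "X * ln (b / a) + Z * ln (1 - b / a) \<le> X * ln (X / T) + Z * ln (Z / T)"
    unfolding T_def using P Z ab by (intro gibbs_two) auto
  also have "\<dots> < X * ln (sin X / sin T) + Z * ln (sin Z / sin T)"
    using lt[of X] lt[of Z] P Z by (intro add_strict_mono) auto
  finally have "X * ln (b / a) + Z * ln (1 - b / a) <
      X * ln (sin X / sin T) + Z * ln (sin Z / sin T)" .
  moreover have "1 - b / a = 1 / a" using ab by (simp add: field_simps)
  ultimately have "X * (ln b - ln a) - Z * ln a <
      X * (ln (sin X) - ln (sin T)) + Z * (ln (sin Z) - ln (sin T))"
    using a ab s by (simp add: ln_div)
  then show ?thesis
    using s a ab unfolding sYT Z(2)[symmetric] by (simp add: ln_div T_def algebra_simps)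
qed

definition unit_triangle :: "real \<Rightarrow> real \<Rightarrow> real \<Rightarrow> real \<Rightarrow> bool" where
  "unit_triangle a b X Y \<longleftrightarrow> 0 < a \<and> 0 < b \<and> X \<in> {0..pi} \<and> Y \<in> {0..pi} \<and>
     a * sin X = b * sin Y \<and> a * cos X + b * cos Y = 1"

lemma unit_triangle_cases:
  assumes "unit_triangle a b X Y"
  obtains (proper) "0 < X" "0 < Y" "X + Y < pi"
      "a = sin Y / sin (X + Y)" "b = sin X / sin (X + Y)"
  | (flat) "X = 0" "Y = 0" "a + b = 1"
  | (left) "X = 0" "Y = pi" "a = 1 + b"
  | (right) "X = pi" "Y = 0" "b = 1 + a"
proof -
  have ab: "0 < a" "0 < b" and XY: "0 \<le> X" "X \<le> pi" "0 \<le> Y" "Y \<le> pi"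
    and e1: "a * sin X = b * sin Y" and e2: "a * cos X + b * cos Y = 1"
    using assms by (auto simp: unit_triangle_def)
  have zero: "sin V = 0 \<longleftrightarrow> V = 0 \<or> V = pi" if "0 \<le> V" "V \<le> pi" for V
    using that sin_gt_zero[of V] by fastforce
  show thesis
  proof (cases "sin X = 0")
    case True
    then have "sin Y = 0" using e1 ab by simp
    then show thesis using True e2 zero XY ab flat left right by force
  next
    case False
    then have Xp: "0 < X" "X < pi" "sin X > 0"
      using XY sin_gt_zero[of X] by (auto simp: zero less_le)
    then have "sin Y > 0" using e1 ab by (metis zero_less_mult_pos mult_pos_pos)
    then have Yp: "0 < Y" "Y < pi" using XY by (auto simp: less_le)
    have "b * sin (X + Y) = sin X * (b * cos Y) + cos X * (b * sin Y)"
      by (simp add: sin_add algebra_simps)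
    also have "\<dots> = sin X * (a * cos X + b * cos Y)"
      unfolding e1[symmetric] by (simp add: algebra_simps)
    finally have b: "b * sin (X + Y) = sin X" using e2 by simp
    then have S: "sin (X + Y) > 0" using Xp ab by (metis zero_less_mult_pos)
    have "a * sin (X + Y) = sin Y * (a * cos X) + cos Y * (a * sin X)"
      by (simp add: sin_add algebra_simps)
    also have "\<dots> = sin Y * (a * cos X + b * cos Y)"
      unfolding e1 by (simp add: algebra_simps)
    finally have a: "a * sin (X + Y) = sin Y" using e2 by simp
    have "X + Y < pi"
    proof (rule ccontr)
      assume "\<not> X + Y < pi"
      then have "sin (X + Y) \<le> 0"
        using Xp Yp by (intro sin_le_zero) auto
      then show False using S by simp
    qed
    then show thesis using proper a b S Xp Yp by (simp add: field_simps)
  qed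
qed

text \<open>Unites the proper and the collapsed case; the collapse at the other vertex follows by
  exchanging the two sides. In the proper case the angles determine the sides, so
  \<open>a1 \<noteq> a0\<close> forces different angles.\<close>

lemma unit_triangle_monotone:
  assumes t0: "unit_triangle a0 b0 X0 Y0" "0 < X0" "0 < Y0"
    and t1: "unit_triangle a1 b1 X1 Y1" "X1 \<noteq> 0 \<or> Y1 \<noteq> 0"
    and ne: "a1 \<noteq> a0"
  shows "0 < (X1 - X0) * (ln b1 - ln b0) + (Y1 - Y0) * (ln a1 - ln a0)"
proof -
  have P0: "X0 + Y0 < pi" "a0 = sin Y0 / sin (X0 + Y0)" "b0 = sin X0 / sin (X0 + Y0)"
    using t0 by (auto elim: unit_triangle_cases)
  have pos: "0 < a1" "0 < b1" using t1 by (auto simp: unit_triangle_def)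
  show ?thesis
    using t1(1)
  proof (cases rule: unit_triangle_cases)
    case proper
    then show ?thesis
      using triangle_angles_monotone[OF t0(2,3) P0(1) proper(1-3)] ne P0 by auto
  next
    case flat
    then show ?thesis using t1(2) by simp
  next
    case left
    then show ?thesis using collapsed_triangle_monotone[OF t0(2,3) P0(1) pos(2)] P0 by simp
  next
    case right
    then show ?thesis
      using collapsed_triangle_monotone[of Y0 X0 a1 b1] t0 P0 pos by (simp add: add.commute)
  qed
qed

text \<open>\<open>A\<close> and \<open>B\<close> have opposite imaginary parts, so the base angle
  at \<open>A\<close> is the argument of \<open>cnj A\<close>; both arguments then lie in
  \<open>[0, pi]\<close>.\<close>

lemma unit_triangle_Arg:
  assumes "A + B = 1" "A \<noteq> 0" "B \<noteq> 0" "0 \<le> Im B"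
  shows "unit_triangle (cmod A) (cmod B) (Arg (cnj A)) (Arg B)"
proof -
  have AB: "Re A + Re B = 1" "Im A = - Im B"
    using assms(1) by (metis plus_complex.sel(1) one_complex.sel(1),
        metis plus_complex.sel(2) one_complex.sel(2) eq_neg_iff_add_eq_0)
  have rA: "cnj A = of_real (cmod A) * cis (Arg (cnj A))"
    using rcis_cmod_Arg[of "cnj A"] by (simp add: rcis_def)
  have rB: "B = of_real (cmod B) * cis (Arg B)"
    using rcis_cmod_Arg[of B] by (simp add: rcis_def)
  have "Re A = cmod A * cos (Arg (cnj A))" "- Im A = cmod A * sin (Arg (cnj A))"
    using arg_cong[OF rA, of Re] arg_cong[OF rA, of Im] by auto
  moreover have "Re B = cmod B * cos (Arg B)" "Im B = cmod B * sin (Arg B)"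
    using arg_cong[OF rB, of Re] arg_cong[OF rB, of Im] by auto
  moreover have "0 \<le> Arg (cnj A)" "0 \<le> Arg B"
    using assms AB by (auto simp: Arg_less_0)
  ultimately show ?thesis
    using assms AB Arg_bounded[of B] Arg_bounded[of "cnj A"]
    by (auto simp: unit_triangle_def)
qed


section \<open>Consecutive Farey fractions\<close>

text \<open>Bezout yields a fraction \<open>a / b\<close> with \<open>q * a - p * b = 1\<close> and
  \<open>n - q < b \<le> n\<close>. It is shown to equal \<open>r / s\<close>, which gives both
  claims.\<close>

lemma farey_pair_consecutive:
  assumes "farey_pair n p q r s"
  shows "q * r = p * s + 1" and "n < q + s"
proof -
  have pq: "p < q" "q \<le> n" "coprime p q" and rs: "r < s" "s \<le> n" "coprime r s"
    and less: "real p / real q < real r / real s"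
    and gap: "\<And>a b. (a, b) \<in> farey n \<Longrightarrow> real p / real q < real a / real b \<Longrightarrow>
       \<not> real a / real b < real r / real s"
    using assms by (auto simp: farey_pair_def farey_def)
  obtain u v where uv: "u * int p + v * int q = 1"
    using bezout_int[of "int p" "int q"] pq(3) by (auto simp: coprime_iff_gcd_eq_1)
  \<comment> \<open>The solutions of the determinant equation have denominators congruent to
    \<open>- u\<close> modulo \<open>q\<close>; this is the one in the interval
    \<open>(n - q, n]\<close>.\<close>
  define b where "b = int n - (int n + u) mod int q"
  define k where "k = (int n + u) div int q"
  have "0 \<le> (int n + u) mod int q" "(int n + u) mod int q < int q"
    using pq by simp_all
  then have b: "int n - int q < b" "b \<le> int n" "0 < b" using pq unfolding b_def by linarith+
  have "int q * k + (int n + u) mod int q = int n + u"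
    unfolding k_def by (rule mult_div_mod_eq)
  then have bk: "b = int q * k - u" by (simp add: b_def)
  define a where "a = int p * k + v"
  have det: "int q * a = int p * b + 1"
    using uv by (simp add: a_def bk algebra_simps)
  have a: "0 < a"
  proof (rule ccontr)
    assume "\<not> 0 < a"
    then have "int q * a \<le> 0" by (simp add: mult_nonneg_nonpos)
    moreover have "0 \<le> int p * b" using b by simp
    ultimately show False using det by simp
  qed
  have less': "int p * int s < int q * int r"
  proof -
    have "real p * real s < real q * real r"
      using less pq rs by (simp add: field_simps)
    then show ?thesis by (metis of_nat_less_iff of_nat_mult)
  qed
  \<comment> \<open>Otherwise \<open>a / b\<close> would be a Farey fraction strictly between the
    two given ones.\<close>
  have le: "int r * b \<le> a * int s"
  proof (rule ccontr)
    assume H: "\<not> int r * b \<le> a * int s"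
    have "a * int s < b * int s"
    proof -
      have "int r * b \<le> int s * b" using rs b by (intro mult_right_mono) auto
      then show ?thesis using H by (simp add: mult.commute)
    qed
    then have ab: "a < b" using rs by simp
    have "coprime a b"
    proof (rule coprimeI)
      fix c assume "c dvd a" "c dvd b"
      then have "c dvd int q * a - int p * b" by simp
      then show "is_unit c" using det by simp
    qed
    then have "(nat a, nat b) \<in> farey n"
      using ab a b coprime_int_iff[of "nat a" "nat b"]
      by (simp add: farey_def nat_less_eq_zless nat_le_iff)
    moreover have "real p / real q < real (nat a) / real (nat b)"
    proof -
      have "of_int (int p * b) < (of_int (int q * a) :: real)"
        using det by (subst of_int_less_iff) simp
      then show ?thesis using a b pq by (simp add: field_simps)
    qed
    moreover have "real (nat a) / real (nat b) < real r / real s"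
    proof -
      have "of_int (a * int s) < (of_int (int r * b) :: real)"
        using H by (subst of_int_less_iff) simp
      then show ?thesis using a b rs by (simp add: field_simps)
    qed
    ultimately show False using gap by blast
  qed
  define D where "D = int q * int r - int p * int s"
  have D: "1 \<le> D" using less' by (simp add: D_def)
  have s: "int s = int q * (a * int s - int r * b) + b * D"
  proof -
    have "int s = (int q * a - int p * b) * int s" using det by simp
    then show ?thesis by (simp add: D_def algebra_simps)
  qed
  \<comment> \<open>If the integer \<open>a * s - r * b\<close> were at least \<open>1\<close>, the
    identity for \<open>s\<close> would give \<open>s \<ge> q + b > n\<close>.\<close>
  have eq: "a * int s = int r * b"
  proof (rule ccontr)
    assume "a * int s \<noteq> int r * b"
    then have "1 \<le> a * int s - int r * b" using le by simp
    then have "int q * 1 \<le> int q * (a * int s - int r * b)"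
      by (intro mult_left_mono) auto
    moreover have "b * 1 \<le> b * D" using D b by (intro mult_left_mono) auto
    ultimately show False using s b rs by linarith
  qed
  then have sb: "int s = b * D" using s by simp
  have "int r = a * D"
    using eq b unfolding sb by simp
  then have "D dvd int r" "D dvd int s" using sb by simp_all
  moreover have "coprime (int r) (int s)" using rs by simp
  ultimately have "is_unit D" by (meson coprime_common_divisor)
  then have D1: "D = 1" using D by auto
  then have "int (q * r) = int (p * s + 1)" by (simp add: D_def)
  then show "q * r = p * s + 1" by (simp only: of_nat_eq_iff)
  show "n < q + s" using sb D1 b by simp
qed

section \<open>Points of the Karpelevich region\<close>

lemma in_Theta_if_two_point_rows:
  fixes v :: "nat \<Rightarrow> complex"
  assumes nz: "\<exists>i<n. v i \<noteq> 0"
    and rows: "\<And>i. i < n \<Longrightarrow> \<exists>j<n. \<exists>k<n. \<exists>b. 0 \<le> b \<and> b \<le> 1 \<and>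
      z * v i = of_real b * v j + of_real (1 - b) * v k"
  shows "z \<in> Theta n"
proof -
  obtain J K b where row: "\<And>i. i < n \<Longrightarrow> J i < n \<and> K i < n \<and> 0 \<le> b i \<and> b i \<le> 1 \<and>
      z * v i = of_real (b i) * v (J i) + of_real (1 - b i) * v (K i)"
    using rows by metis
  \<comment> \<open>The two contributions are added, so a row with \<open>J i = K i\<close> still
    has sum \<open>1\<close>.\<close>
  define A where "A = (\<lambda>i j. (if j = J i then b i else 0) + (if j = K i then 1 - b i else 0))"
  have "stochastic n A"
    using row by (auto simp: stochastic_def A_def sum.distrib)
  moreover have "(\<Sum>j<n. complex_of_real (A i j) * v j) = z * v i" if "i < n" for i
  proof -
    have "complex_of_real (A i j) * v j = (if j = J i then of_real (b i) * v j else 0) +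
        (if j = K i then of_real (1 - b i) * v j else 0)" for j
      by (auto simp: A_def algebra_simps)
    then show ?thesis using row[OF that] by (simp add: sum.distrib)
  qed
  ultimately show ?thesis
    using nz unfolding Theta_def is_eigenvalue_def by blast
qed

text \<open>Mixing \<open>A\<close> with the matrix whose column \<open>i0\<close> consists of ones
  multiplies an eigenvalue other than \<open>1\<close> by \<open>c\<close>; the eigenvector changes
  by a constant vector, an eigenvector of \<open>A\<close> for \<open>1\<close>. The constant
  \<open>k\<close> solves \<open>k * (1 - c * z) + (1 - c) * v i0 = 0\<close>.\<close>

lemma Theta_starlike:
  assumes z: "z \<in> Theta n" "z \<noteq> 1" and c: "0 \<le> c" "c \<le> 1" "of_real c * z \<noteq> 1"
  shows "of_real c * z \<in> Theta n"
proof -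
  obtain A v i0 where A: "stochastic n A" and i0: "i0 < n" "v i0 \<noteq> 0"
    and ev: "\<And>i. i < n \<Longrightarrow> (\<Sum>j<n. complex_of_real (A i j) * v j) = z * v i"
    using z by (auto simp: Theta_def is_eigenvalue_def)
  define B where "B = (\<lambda>i j. c * A i j + (if j = i0 then 1 - c else 0))"
  define k where "k = - (1 - of_real c) * v i0 / (1 - of_real c * z)"
  have rowsum: "(\<Sum>j<n. complex_of_real (A i j)) = 1" if "i < n" for i
    using A that unfolding stochastic_def by (metis of_real_1 of_real_sum)
  have "stochastic n B"
    using A c i0 by (auto simp: stochastic_def B_def sum.distrib sum_distrib_left[symmetric])
  moreover have "(\<Sum>j<n. complex_of_real (B i j) * (v j + k)) = of_real c * z * (v i + k)"
    if i: "i < n" for i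
  proof -
    have "complex_of_real (B i j) * (v j + k) =
        of_real c * (of_real (A i j) * v j) + of_real c * k * of_real (A i j) +
        (if j = i0 then (1 - of_real c) * (v j + k) else 0)" for j
      by (auto simp: B_def algebra_simps)
    then have "(\<Sum>j<n. complex_of_real (B i j) * (v j + k)) =
        of_real c * (z * v i) + of_real c * k + (1 - of_real c) * (v i0 + k)"
      using ev[OF i] rowsum[OF i] i0 by (simp add: sum.distrib sum_distrib_left[symmetric])
    also have "\<dots> = of_real c * z * (v i + k) + (k * (1 - of_real c * z) + (1 - of_real c) * v i0)"
      by (simp add: algebra_simps)
    also have "k * (1 - of_real c * z) + (1 - of_real c) * v i0 = 0"
      using c(3) by (simp add: k_def) (simp add: algebra_simps)
    finally show ?thesis by simp
  qed
  \<comment> \<open>If the shifted vector vanished, \<open>v\<close> would be constant and its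
    eigenvalue would be \<open>1\<close>.\<close>
  moreover have "\<exists>i<n. v i + k \<noteq> 0"
  proof (rule ccontr)
    assume "\<not> ?thesis"
    then have const: "v i = - k" if "i < n" for i
      using that by (metis add_eq_0_iff2 add.commute)
    have "z * v i0 = (\<Sum>j<n. complex_of_real (A i0 j) * (- k))"
      using ev[OF i0(1)] const by (metis (no_types, lifting) lessThan_iff sum.cong)
    also have "\<dots> = v i0"
      using rowsum[OF i0(1)] const[OF i0(1)] by (simp add: sum_distrib_right[symmetric] sum_negf)
    finally show False using i0 z by simp
  qed
  ultimately have "stochastic n B \<and> is_eigenvalue n B (of_real c * z)"
    unfolding is_eigenvalue_def by (intro conjI exI[of _ "\<lambda>i. v i + k"]) auto
  then show ?thesis unfolding Theta_def by blast
qed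

text \<open>The digraph of the matrix consists of \<open>d\<close> cycles of length \<open>q\<close> threaded by one cycle of
  length \<open>s\<close>: vertex \<open>k\<close> lies at position \<open>k mod q\<close> of cycle \<open>k div q\<close>, and \<open>c\<close> is the ratio
  between the entries of the eigenvector on successive cycles.\<close>

lemma threaded_cycles_in_Theta:
  fixes z c :: complex
  assumes q: "2 \<le> q" and d: "0 < d" and len: "q * d \<le> n" "s \<le> n" "0 < s"
    and near: "q * d < s + q" "s < q * d + q"
    and \<alpha>: "0 \<le> \<alpha>" "\<alpha> \<le> 1" and z: "z \<noteq> 0"
    and zq: "z ^ q = of_real (1 - \<alpha>) + of_real \<alpha> * c"
    and cd: "c ^ d * z ^ s = z ^ (q * d)"
  shows "z \<in> Theta n"
proof -
  \<comment> \<open>Vertices from \<open>N\<close> on only pad the matrix to size \<open>n\<close>: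
    they carry a loop and the eigenvector entry \<open>0\<close>.\<close>
  define N where "N = max (q * d) s"
  define v where "v = (\<lambda>k. if k < N then z ^ (k mod q) * c ^ (k div q) else 0)"
  have N: "N \<le> n" "0 < N" using len by (auto simp: N_def)
  show ?thesis
  proof (rule in_Theta_if_two_point_rows)
    show "\<exists>i<n. v i \<noteq> 0"
      using N by (intro exI[of _ 0]) (auto simp: v_def)
  next
    fix k assume k: "k < n"
    let ?case = "\<exists>j<n. \<exists>l<n. \<exists>b. 0 \<le> b \<and> b \<le> 1 \<and>
      z * v k = of_real b * v j + of_real (1 - b) * v l"
    have single: ?case if "z * v k = v j" "j < n" for j
      using that by (intro exI[of _ j] conjI exI[of _ "1::real"]) auto
    have split: ?case if "z * v k = of_real (1 - \<alpha>) * v j + of_real \<alpha> * v l" "j < n" "l < n" for j l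
      using that \<alpha> by (intro exI[of _ j] exI[of _ l] conjI exI[of _ "1 - \<alpha>"]) auto
    show ?case
    proof (cases "k < N")
      case False
      then show ?thesis using single[of k] k by (simp add: v_def)
    next
      case kN: True
      show ?thesis
      proof (cases "Suc k mod q = 0")
        case False
        then have m: "Suc k mod q = Suc (k mod q)" "Suc k div q = k div q"
          by (auto simp: mod_Suc div_Suc split: if_splits)
        show ?thesis
        proof (cases "Suc k < N")
          case True
          then show ?thesis using single[of "Suc k"] m N kN by (simp add: v_def)
        next
          \<comment> \<open>The end of the incomplete extra cycle that occurs for
            \<open>q * d < s\<close>; from here the long cycle returns to vertex
            \<open>0\<close>.\<close>
          case F2: False
          then have "Suc k = N" using kN by simp
          moreover have "Suc k \<noteq> q * d" using False by auto
          ultimately have sk: "Suc k = s" "q * d < s"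
            by (auto simp: N_def max_def split: if_splits)
          have dk: "k div q = d"
            using sk near by (intro div_nat_eqI) (simp_all add: mult.commute)
          then have "q * d + k mod q = k" by (metis mult_div_mod_eq)
          then have "z ^ (q * d) * (z * (z ^ (k mod q) * c ^ d)) = z ^ Suc k * c ^ d"
            by (metis (no_types, opaque_lifting) mult.assoc mult.left_commute power_Suc power_add)
          also have "\<dots> = z ^ (q * d) * 1" using cd sk by (simp add: mult.commute)
          finally have "z * (z ^ (k mod q) * c ^ d) = 1" using z by simp
          then show ?thesis using single[of 0] kN N dk by (simp add: v_def)
        qed
      next
        case True
        define i where "i = k div q"
        have ki: "k mod q = q - 1" using True q by (auto simp: mod_Suc split: if_splits)
        then have k_eq: "k = q * i + (q - 1)" by (metis i_def mult_div_mod_eq)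
        then have ks: "Suc k = q * Suc i" using q by simp
        have zv: "z * v k = of_real (1 - \<alpha>) * c ^ i + of_real \<alpha> * c ^ Suc i"
        proof -
          have "z * v k = z ^ Suc (q - 1) * c ^ i" using kN ki by (simp add: v_def i_def)
          also have "Suc (q - 1) = q" using q by simp
          finally show ?thesis unfolding zq by (simp add: algebra_simps)
        qed
        have vi: "q * i < N" "v (q * i) = c ^ i" using k_eq kN q by (auto simp: v_def)
        show ?thesis
        proof (cases "Suc k < N")
          case True
          then have "v (Suc k) = c ^ Suc i" unfolding ks v_def using q by simp
          then show ?thesis
            using split[of "q * i" "Suc k"] zv vi N True by simp
        next
          case False
          then have "q * Suc i = N" using kN ks by simp
          have "N = q * d"
          proof (rule ccontr)
            assume "N \<noteq> q * d"
            then have "q * d < q * Suc i" "q * Suc i < q * Suc d"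
              using \<open>q * Suc i = N\<close> near by (auto simp: N_def max_def split: if_splits)
            then show False by (simp only: mult_less_cancel1) auto
          qed
          then have "s \<le> q * d" by (simp add: N_def max_def split: if_splits)
          have "q * Suc i = q * d" using \<open>q * Suc i = N\<close> \<open>N = q * d\<close> by (rule trans)
          then have di: "Suc i = d" using q by (simp only: mult_cancel1) simp
          \<comment> \<open>For \<open>s \<le> q * d\<close> the long cycle closes by entering the
            first cycle at position \<open>e\<close>, which makes its length \<open>s\<close>; there
            the eigenvector entry is \<open>z ^ e = c ^ d\<close>.\<close>
          define e where "e = q * d - s"
          have e: "e < q" "q * d = e + s" "e < N"
            using near(1) \<open>s \<le> q * d\<close> len(3) \<open>N = q * d\<close> unfolding e_def by linarith+
          have "c ^ d * z ^ s = z ^ e * z ^ s" using cd e by (simp add: power_add)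
          then have "c ^ d = z ^ e" using z by simp
          then have "v e = c ^ Suc i" using e di by (simp add: v_def)
          then show ?thesis using split[of "q * i" e] zv vi N e by simp
        qed
      qed
    qed
  qed
qed


lemma sin_add_le:
  fixes a b :: real
  assumes "0 \<le> sin a" "0 \<le> sin b"
  shows "sin (a + b) \<le> sin a + sin b"
proof -
  have "sin a * cos b \<le> sin a" "sin b * cos a \<le> sin b"
    using assms by (simp_all add: mult_left_le)
  then show ?thesis by (simp add: sin_add mult.commute)
qed

section \<open>The arc between two consecutive Farey fractions\<close>

locale farey_arc =
  fixes n p q r s d :: nat
  assumes q2: "2 \<le> q" and qs: "q < s" and sn: "s \<le> n"
    and det: "q * r = p * s + 1" and gap: "n < q + s" and d_def: "d = n div q"
begin

text \<open>The arguments of \<open>t\<^sup>q\<close> and of \<open>t\<^bsup>-s\<^esup>\<close> for \<open>t\<close> on the ray of argument \<open>\<theta>\<close>, with the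
  multiples of \<open>2\<pi>\<close> chosen so that both are positive exactly on the open arc.\<close>

definition xang :: "real \<Rightarrow> real" where "xang \<theta> = real q * \<theta> - 2 * pi * real p"
definition yang :: "real \<Rightarrow> real" where "yang \<theta> = 2 * pi * real r - real s * \<theta>"

text \<open>Both \<open>q * d\<close> and \<open>s\<close> lie in \<open>(n - q, n]\<close>: the
  first is the largest multiple of \<open>q\<close> up to \<open>n\<close>, the second satisfies
  \<open>n < q + s\<close>. Hence they differ by less than \<open>q\<close>.\<close>

lemma qd_bounds: "0 < d" "q * d \<le> n" "q * d < s + q" "s < q * d + q"
proof -
  have "n mod q < q" using q2 by simp
  moreover have "n = q * d + n mod q" by (simp add: d_def)
  ultimately show "q * d \<le> n" "q * d < s + q" "s < q * d + q" using sn gap by linarith+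
  show "0 < d" using qs sn q2 by (simp add: d_def div_greater_zero_iff)
qed

text \<open>By the determinant relation \<open>\<theta>\<close> cancels. The angles
  \<open>xang \<theta>\<close> and \<open>yang \<theta> / real d\<close> thus satisfy the angle
  equation of the overview with \<open>m = 1\<close>.\<close>

lemma angle_sum: "real s * xang \<theta> + real q * yang \<theta> = 2 * pi"
proof -
  have "real q * real r = real p * real s + 1" using det by (metis of_nat_1 of_nat_add of_nat_mult)
  then have "2 * pi * (real q * real r) = 2 * pi * (real p * real s + 1)" by simp
  then show ?thesis by (simp add: xang_def yang_def algebra_simps)
qed

lemma angle_bounds:
  assumes "0 < xang \<theta>" "0 < yang \<theta>"
  shows "xang \<theta> + yang \<theta> < pi" "xang \<theta> + yang \<theta> / real d < pi" "xang \<theta> < pi" "yang \<theta> < pi"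
proof -
  have "2 * xang \<theta> < real s * xang \<theta>" "2 * yang \<theta> \<le> real q * yang \<theta>"
    using assms q2 qs by simp_all
  then show xy: "xang \<theta> + yang \<theta> < pi" using angle_sum[of \<theta>] by linarith
  then show "xang \<theta> < pi" "yang \<theta> < pi" using assms by auto
  have "yang \<theta> / real d \<le> yang \<theta>"
    using assms qd_bounds(1) by (simp add: field_simps)
  then show "xang \<theta> + yang \<theta> / real d < pi" using xy by simp
qed

lemma cis_xang: "cis \<theta> ^ q = cis (xang \<theta>)"
proof -
  have "cis (xang \<theta>) = cis (real q * \<theta>) / cis (2 * pi * real p)"
    unfolding xang_def by (rule cis_divide[symmetric])
  also have "cis (2 * pi * real p) = 1" by (rule cis_multiple_2pi) simp
  finally show ?thesis by (simp add: Complex.DeMoivre)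
qed

lemma cis_yang: "cis (yang \<theta>) * cis \<theta> ^ s = 1"
proof -
  have "cis (yang \<theta>) * cis \<theta> ^ s = cis (2 * pi * real r)"
    by (simp add: yang_def Complex.DeMoivre cis_mult)
  then show ?thesis by (simp add: cis_multiple_2pi)
qed

section \<open>Principal points on a ray and the points below them\<close>

lemma ray_neq_1:
  assumes "0 < xang \<theta>" "0 < yang \<theta>" "0 < R"
  shows "(of_real R * cis \<theta>) ^ q \<noteq> 1" "of_real R * cis \<theta> \<noteq> 1"
proof -
  have "(of_real R * cis \<theta>) ^ q = of_real (R ^ q) * cis (xang \<theta>)"
    by (simp add: power_mult_distrib cis_xang)
  then have "Im ((of_real R * cis \<theta>) ^ q) = R ^ q * sin (xang \<theta>)" by simp
  moreover have "0 < sin (xang \<theta>)" using assms angle_bounds[of \<theta>] by (intro sin_gt_zero) auto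
  ultimately have "0 < Im ((of_real R * cis \<theta>) ^ q)" using assms by simp
  then show "(of_real R * cis \<theta>) ^ q \<noteq> 1" by fastforce
  then show "of_real R * cis \<theta> \<noteq> 1" by force
qed

text \<open>The equation says that the triangle with base angles \<open>xang \<theta>\<close> and
  \<open>yang \<theta> / real d\<close> yields weights \<open>R ^ q * a\<close> and
  \<open>R powr k * b\<close> with sum \<open>1\<close>. These serve as \<open>1 - \<alpha>\<close>
  and \<open>\<alpha>\<close> for the threaded cycles.\<close>

lemma principal_point_in_Theta:
  assumes xy: "0 < xang \<theta>" "0 < yang \<theta>" and R: "0 < R"
    and eq: "R ^ q * sin (yang \<theta> / real d) + R powr (real s / real d) * sin (xang \<theta>) =
      sin (xang \<theta> + yang \<theta> / real d)"
  shows "of_real R * cis \<theta> \<in> Theta n"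
proof -
  define x y where "x = xang \<theta>" and "y = yang \<theta> / real d"
  define k where "k = real s / real d"
  define S where "S = sin (x + y)"
  have d: "0 < real d" using qd_bounds by simp
  have bounds: "0 < x" "0 < y" "x + y < pi"
    using xy d angle_bounds[OF xy] by (simp_all add: x_def y_def)
  then have sn0: "0 < sin x" "0 < sin y" "0 < S"
    by (auto simp: S_def intro!: sin_gt_zero)
  have eq': "R ^ q * sin y + R powr k * sin x = S"
    using eq by (simp add: x_def y_def k_def S_def)
  define z where "z = of_real R * cis \<theta>"
  define \<alpha> where "\<alpha> = R powr k * sin x / S"
  \<comment> \<open>The \<open>d\<close>-th root of \<open>z ^ (q * d) / z ^ s\<close> selected by
    the angle \<open>y\<close>.\<close>
  define c where "c = z ^ q * of_real (R powr (- k)) * cis y"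
  have zq: "z ^ q = of_real (R ^ q) * cis x"
    by (simp add: z_def power_mult_distrib cis_xang x_def)
  have \<alpha>1: "1 - \<alpha> = R ^ q * sin y / S"
    using eq' sn0 by (simp add: \<alpha>_def field_simps)
  have \<alpha>0: "0 \<le> \<alpha>" using sn0 by (simp add: \<alpha>_def)
  have "0 \<le> 1 - \<alpha>" unfolding \<alpha>1 using sn0 R by simp
  then have \<alpha>2: "\<alpha> \<le> 1" by simp
  \<comment> \<open>The closing relation \<open>a * cis (- x) + b * cis y = 1\<close> of the
    triangle, multiplied by \<open>S * cis x\<close>.\<close>
  have cis_eq: "of_real S * cis x = of_real (sin y) + of_real (sin x) * cis (x + y)"
  proof (rule complex_eqI)
    have "sin y = sin ((x + y) - x)" by simp
    then show "Re (of_real S * cis x) = Re (of_real (sin y) + of_real (sin x) * cis (x + y))"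
      unfolding sin_diff by (simp add: S_def algebra_simps)
  qed (simp add: S_def)
  have Rk: "R powr k * R powr (- k) = 1" using R by (simp add: powr_minus)
  have \<alpha>c: "of_real \<alpha> * c = of_real (R ^ q) * of_real (sin x / S) * cis (x + y)"
  proof -
    have "of_real \<alpha> * c = of_real (R powr k * R powr (- k)) * of_real (sin x / S) *
        (of_real (R ^ q) * (cis x * cis y))"
      unfolding c_def zq \<alpha>_def by simp
    then show ?thesis unfolding Rk by (simp add: cis_mult)
  qed
  have "of_real (1 - \<alpha>) + of_real \<alpha> * c =
      of_real (R ^ q / S) * (of_real (sin y) + of_real (sin x) * cis (x + y))"
    unfolding \<alpha>c \<alpha>1 by (simp add: algebra_simps add_divide_distrib)
  also have "\<dots> = z ^ q"
    unfolding cis_eq[symmetric] zq using sn0 by simp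
  finally have zq': "z ^ q = of_real (1 - \<alpha>) + of_real \<alpha> * c" ..
  have cd: "c ^ d * z ^ s = z ^ (q * d)"
  proof -
    have "(R powr (- k)) ^ d = R powr (- real s)"
      using R d by (simp add: powr_realpow[symmetric] powr_powr k_def)
    then have Rd: "(R powr (- k)) ^ d * R ^ s = 1"
      using R by (simp add: powr_minus powr_realpow)
    have yd: "cis y ^ d = cis (yang \<theta>)" using d by (simp add: Complex.DeMoivre y_def)
    have "c ^ d * z ^ s = z ^ (q * d) * of_real ((R powr (- k)) ^ d * R ^ s) *
        (cis y ^ d * cis \<theta> ^ s)"
      by (simp add: c_def power_mult_distrib power_mult) (simp add: z_def power_mult_distrib)
    then show ?thesis unfolding Rd yd cis_yang by simp
  qed
  have "z \<noteq> 0" using R by (simp add: z_def)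
  then have "z \<in> Theta n"
    using threaded_cycles_in_Theta[OF q2 qd_bounds(1,2) sn _ qd_bounds(3,4) \<alpha>0 \<alpha>2 _ zq' cd] qs
    by simp
  then show ?thesis by (simp add: z_def)
qed

text \<open>Subadditivity of the sine reverses the inequality at radius \<open>1\<close>, so some
  principal point on the ray has radius in \<open>[\<rho>, 1]\<close>; starlikeness brings it down
  to \<open>\<rho>\<close>.\<close>

lemma below_principal_in_Theta:
  assumes xy: "0 < xang \<theta>" "0 < yang \<theta>" and \<rho>: "0 < \<rho>" "\<rho> < 1"
    and le: "\<rho> ^ q * sin (yang \<theta> / real d) + \<rho> powr (real s / real d) * sin (xang \<theta>) \<le>
      sin (xang \<theta> + yang \<theta> / real d)"
  shows "of_real \<rho> * cis \<theta> \<in> Theta n"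
proof -
  define f where "f = (\<lambda>R. R ^ q * sin (yang \<theta> / real d) +
      R powr (real s / real d) * sin (xang \<theta>))"
  define y where "y = yang \<theta> / real d"
  have y: "0 < y" "xang \<theta> + y < pi"
    using xy qd_bounds(1) angle_bounds[OF xy] by (simp_all add: y_def)
  have sn0: "0 < sin (xang \<theta>)" "0 < sin y"
    using xy y by (auto intro!: sin_gt_zero)
  then have "sin (xang \<theta> + y) \<le> f 1"
    using sin_add_le[of "xang \<theta>" y] by (simp add: f_def y_def)
  moreover have "f \<rho> \<le> sin (xang \<theta> + y)" using le by (simp add: f_def y_def)
  moreover have "continuous_on {\<rho>..1} f"
    unfolding f_def using \<rho> by (auto intro!: continuous_intros)
  ultimately obtain R where R: "\<rho> \<le> R" "R \<le> 1" "f R = sin (xang \<theta> + y)"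
    using IVT'[of f \<rho> "sin (xang \<theta> + y)" 1] \<rho> by auto
  have R0: "0 < R" using R \<rho> by simp
  have "of_real R * cis \<theta> \<in> Theta n"
    using principal_point_in_Theta[OF xy R0] R(3) by (simp add: f_def y_def)
  moreover have "of_real (\<rho> / R) * (of_real R * cis \<theta>) = of_real \<rho> * cis \<theta>"
    using R0 by simp
  ultimately show ?thesis
    using Theta_starlike[of "of_real R * cis \<theta>" n "\<rho> / R"] ray_neq_1(2)[OF xy R0]
      ray_neq_1(2)[OF xy \<rho>(1)] R(1) R0 \<rho>(1) by (metis divide_le_eq_1_pos divide_nonneg_pos less_imp_le)
qed

text \<open>A larger angle \<open>Y\<close> makes the inequality of
  \<open>below_principal_in_Theta\<close> strict. By continuity it persists in a neighbourhood of
  the point, which therefore lies in the region.\<close>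

lemma nonprincipal_interior:
  assumes xy: "0 < xang \<theta>" "0 < yang \<theta>" and \<rho>: "0 < \<rho>" "\<rho> < 1"
    and Y: "yang \<theta> / real d < Y" "xang \<theta> + Y < pi"
    and eq: "\<rho> ^ q * sin Y + \<rho> powr (real s / real d) * sin (xang \<theta>) = sin (xang \<theta> + Y)"
  shows "of_real \<rho> * cis \<theta> \<in> interior (Theta n)"
proof -
  define t where "t = of_real \<rho> * cis \<theta>"
  define k where "k = real s / real d"
  define x y where "x = xang \<theta>" and "y = yang \<theta> / real d"
  have d: "0 < real d" using qd_bounds by simp
  have b: "0 < x" "0 < y" "y < Y" "x + Y < pi" using xy Y d by (simp_all add: x_def y_def)
  have sn0: "0 < sin x" "0 < sin y" "0 < sin Y" "0 < sin (Y - y)"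
    using b by (auto intro!: sin_gt_zero)
  have strict: "\<rho> ^ q * sin y + \<rho> powr k * sin x < sin (x + y)"
  proof -
    \<comment> \<open>The sinusoid \<open>f\<close> exceeds \<open>c\<close> at \<open>0\<close> and equals \<open>c\<close> at \<open>Y\<close>, so it exceeds \<open>c\<close> in between.\<close>
    define f where "f = (\<lambda>v. sin (x + v) - \<rho> ^ q * sin v)"
    define c where "c = \<rho> powr k * sin x"
    have "\<rho> powr k < 1 powr k"
      using \<rho> d qs by (intro powr_less_mono2) (auto simp: k_def)
    then have c: "0 < c" "c < f 0" using sn0 \<rho> by (simp_all add: c_def f_def)
    have fY: "f Y = c" using eq by (simp add: f_def c_def x_def k_def)
    have "f y * sin Y = f 0 * sin (Y - y) + f Y * sin y"
    proof -
      have "sin (x + y) * sin Y = sin x * sin (Y - y) + sin (x + Y) * sin y"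
        by (simp add: sin_add sin_diff algebra_simps)
      then show ?thesis by (simp add: f_def algebra_simps)
    qed
    moreover have "c * sin (Y - y) < f 0 * sin (Y - y)" using c sn0 by simp
    ultimately have "c * (sin (Y - y) + sin y) < f y * sin Y"
      using fY by (simp add: algebra_simps)
    moreover have "sin Y \<le> sin (Y - y) + sin y"
      using sin_add_le[of "Y - y" y] sn0 by simp
    then have "c * sin Y \<le> c * (sin (Y - y) + sin y)" using c by (intro mult_left_mono) auto
    ultimately have "c * sin Y < f y * sin Y" by linarith
    then have "c < f y" using sn0 by simp
    then show ?thesis by (simp add: f_def c_def)
  qed
  \<comment> \<open>A branch of the argument that is continuous at \<open>t\<close> and takes the
    value \<open>\<theta>\<close> there, wherever the cut of \<open>Arg\<close> lies.\<close>
  define T where "T = (\<lambda>z. \<theta> + Arg (z / t))"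
  have t0: "t \<noteq> 0" using \<rho> by (simp add: t_def)
  have polar: "z = of_real (cmod z) * cis (T z)" for z
  proof -
    have "z / t = of_real (cmod z / \<rho>) * cis (Arg (z / t))"
      using rcis_cmod_Arg[of "z / t"] \<rho> by (simp add: rcis_def t_def norm_divide norm_mult)
    then have "z = t * (of_real (cmod z / \<rho>) * cis (Arg (z / t)))"
      using t0 by (simp add: field_simps)
    also have "\<dots> = of_real (cmod z) * (cis \<theta> * cis (Arg (z / t)))"
      using \<rho> by (simp add: t_def)
    finally show ?thesis by (simp add: T_def cis_mult)
  qed
  have Tt: "T t = \<theta>" "cmod t = \<rho>" using t0 \<rho> by (simp_all add: T_def t_def norm_mult)
  have "isCont Arg (t / t)" using t0 by (intro continuous_at_Arg) auto
  then have "isCont (\<lambda>z. Arg (z / t)) t"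
    using t0 by (intro isCont_o2[of t "\<lambda>z. z / t" Arg]) auto
  then have T: "isCont T t" unfolding T_def by (intro continuous_intros)
  have ev: "\<forall>\<^sub>F z in nhds t. 0 < g z" if "isCont g t" "0 < g t" for g :: "complex \<Rightarrow> real"
    using that order_tendstoD(1)[of g "g t" "nhds t" 0]
    by (simp add: isCont_def tendsto_at_iff_tendsto_nhds)
  have "\<forall>\<^sub>F z in nhds t. 0 < xang (T z)"
    by (rule ev) (use xy Tt T in \<open>auto simp: xang_def intro!: continuous_intros\<close>)
  moreover have "\<forall>\<^sub>F z in nhds t. 0 < yang (T z)"
    by (rule ev) (use xy Tt T in \<open>auto simp: yang_def intro!: continuous_intros\<close>)
  moreover have "\<forall>\<^sub>F z in nhds t. 0 < cmod z"
    by (rule ev) (use \<rho> Tt in \<open>auto intro!: continuous_intros\<close>)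
  moreover have "\<forall>\<^sub>F z in nhds t. 0 < 1 - cmod z"
    by (rule ev) (use \<rho> Tt in \<open>auto intro!: continuous_intros\<close>)
  moreover have "\<forall>\<^sub>F z in nhds t. 0 < sin (xang (T z) + yang (T z) / real d) -
      (cmod z ^ q * sin (yang (T z) / real d) + cmod z powr k * sin (xang (T z)))"
  proof (rule ev)
    show "isCont (\<lambda>z. sin (xang (T z) + yang (T z) / real d) -
      (cmod z ^ q * sin (yang (T z) / real d) + cmod z powr k * sin (xang (T z)))) t"
      unfolding xang_def yang_def using T d t0 by (intro continuous_intros) auto
  qed (use strict Tt in \<open>simp add: x_def y_def\<close>)
  ultimately have "\<forall>\<^sub>F z in nhds t. z \<in> Theta n"
  proof eventually_elim
    case (elim z)
    then have "of_real (cmod z) * cis (T z) \<in> Theta n"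
      by (intro below_principal_in_Theta) (auto simp: k_def)
    then show ?case using polar[of z] by simp
  qed
  then show ?thesis
    unfolding t_def eventually_nhds by (auto intro: interiorI)
qed


end

section \<open>Roots as triangles, and comparison of their moduli\<close>

lemma cis_eq_1_imp_multiple:
  assumes "cis v = 1"
  obtains m :: int where "v = 2 * pi * of_int m"
proof -
  have "cos v = 1" using assms by (metis cis.sel(1) one_complex.sel(1))
  then show thesis using that by (auto simp: cos_one_2pi_int mult_ac)
qed

lemma positive_real_of_cis:
  assumes "of_real M * cis v = of_real K" "0 < M" "0 < K"
  shows "cis v = 1"
proof -
  have "cmod (of_real M * cis v) = cmod (of_real K)" using assms(1) by simp
  then have "M = K" using assms(2,3) by (simp add: norm_mult)
  then show ?thesis using assms by simp
qed

context farey_arc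
begin

lemma phi_root_iff:
  assumes "w \<noteq> 0"
  shows "phi q s d \<alpha> w = 0 \<longleftrightarrow> (1 - of_real (1 - \<alpha>) / w ^ q) ^ d * w ^ s = of_real \<alpha> ^ d"
proof -
  have "(1 - c / w ^ q) * w ^ q = w ^ q - c" for c
    using assms by (simp add: left_diff_distrib)
  then have e1: "(w ^ q - of_real (1 - \<alpha>)) ^ d = (1 - of_real (1 - \<alpha>) / w ^ q) ^ d * w ^ (q * d)"
    by (metis power_mult power_mult_distrib)
  have "w powi (int q * int d - int s) = w powi (int q * int d) / w powi (int s)"
    using assms by (simp add: power_int_diff)
  then have e2: "w powi (int q * int d - int s) = w ^ (q * d) / w ^ s"
    by (metis of_nat_mult power_int_of_nat)
  have "phi q s d \<alpha> w * w ^ s = w ^ (q * d) *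
      ((1 - of_real (1 - \<alpha>) / w ^ q) ^ d * w ^ s - of_real \<alpha> ^ d)"
    unfolding phi_def e1 e2 using assms by (simp add: algebra_simps)
  then show ?thesis using assms by (metis eq_iff_diff_eq_0 mult_eq_0_iff power_not_zero)
qed

definition sideA :: "real \<Rightarrow> complex \<Rightarrow> complex" where "sideA \<alpha> w = of_real (1 - \<alpha>) / w ^ q"

lemma sides_of_root:
  assumes \<alpha>: "0 < \<alpha>" "\<alpha> < 1" and w: "w \<noteq> 0" and root: "phi q s d \<alpha> w = 0"
  shows "sideA \<alpha> w \<noteq> 0" "1 - sideA \<alpha> w \<noteq> 0"
    and "(1 - sideA \<alpha> w) ^ d * w ^ s = of_real \<alpha> ^ d"
    and "cmod (sideA \<alpha> w) = (1 - \<alpha>) / cmod w ^ q"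
    and "cmod (1 - sideA \<alpha> w) = \<alpha> / cmod w powr (real s / real d)"
proof -
  show B: "(1 - sideA \<alpha> w) ^ d * w ^ s = of_real \<alpha> ^ d"
    using root w by (simp add: phi_root_iff sideA_def)
  show "sideA \<alpha> w \<noteq> 0" using \<alpha> w by (simp add: sideA_def)
  have d: "0 < d" using qd_bounds by simp
  show "1 - sideA \<alpha> w \<noteq> 0"
  proof
    assume "1 - sideA \<alpha> w = 0"
    then show False using B \<alpha> d by (simp add: power_0_left)
  qed
  have "cmod (of_real (1 - \<alpha>)) = 1 - \<alpha>" using \<alpha> by (subst norm_of_real) simp
  then show "cmod (sideA \<alpha> w) = (1 - \<alpha>) / cmod w ^ q"
    unfolding sideA_def norm_divide norm_power by simp
  have "cmod (1 - sideA \<alpha> w) ^ d * cmod w ^ s = \<alpha> ^ d"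
    using arg_cong[OF B, of cmod] \<alpha> by (simp add: norm_mult norm_power)
  moreover have "(cmod w powr (real s / real d)) ^ d = cmod w ^ s"
    using w d by (simp add: powr_realpow[symmetric] powr_powr)
  ultimately have "cmod (1 - sideA \<alpha> w) ^ d = (\<alpha> / cmod w powr (real s / real d)) ^ d"
    using w by (simp add: power_divide field_simps)
  then show "cmod (1 - sideA \<alpha> w) = \<alpha> / cmod w powr (real s / real d)"
    using \<alpha> d by (elim power_eq_imp_eq_base) auto
qed

text \<open>In \<open>cnj A ^ s * B ^ (q * d)\<close> the root enters only through
  \<open>w * cnj w\<close>, so the product is a positive real and its argument is a multiple of
  \<open>2 * pi\<close>.\<close>

lemma root_angles_quantized:
  assumes \<alpha>: "0 < \<alpha>" "\<alpha> < 1" and w: "w \<noteq> 0" and root: "phi q s d \<alpha> w = 0"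
  obtains m :: int where
    "real s * Arg (cnj (sideA \<alpha> w)) + real q * real d * Arg (1 - sideA \<alpha> w) = 2 * pi * of_int m"
proof -
  define A where "A = sideA \<alpha> w"
  define B where "B = 1 - A"
  note S = sides_of_root[OF \<alpha> w root, folded A_def, folded B_def]
  have rA: "cnj A = of_real (cmod A) * cis (Arg (cnj A))"
    using rcis_cmod_Arg[of "cnj A"] by (simp add: rcis_def)
  have rB: "B = of_real (cmod B) * cis (Arg B)"
    using rcis_cmod_Arg[of B] by (simp add: rcis_def)
  have "cnj A ^ s * B ^ (q * d) =
      of_real (cmod A ^ s * cmod B ^ (q * d)) *
      cis (real s * Arg (cnj A) + real q * real d * Arg B)"
    by (subst rA, subst rB)
      (simp add: power_mult_distrib Complex.DeMoivre cis_mult[symmetric] mult_ac)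
  moreover have "cnj A ^ s * B ^ (q * d) =
      of_real ((1 - \<alpha>) ^ s * \<alpha> ^ (q * d) / cmod w ^ (2 * (s * q)))"
  proof -
    have "B ^ d = of_real \<alpha> ^ d / w ^ s" using S(3) w by (simp add: field_simps)
    then have Bqd: "B ^ (q * d) = of_real \<alpha> ^ (q * d) / w ^ (s * q)"
      by (metis mult.commute power_divide power_mult)
    have "cnj A ^ s = of_real (1 - \<alpha>) ^ s / cnj w ^ (s * q)"
      by (simp add: A_def sideA_def power_divide mult.commute power_mult[symmetric])
    then have "cnj A ^ s * B ^ (q * d) =
        of_real ((1 - \<alpha>) ^ s * \<alpha> ^ (q * d)) / (w * cnj w) ^ (s * q)"
      unfolding Bqd by (simp add: power_mult_distrib mult_ac)
    also have "w * cnj w = of_real ((cmod w)\<^sup>2)"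
      by (simp add: complex_norm_square[symmetric])
    finally show ?thesis by (simp add: power_mult[symmetric])
  qed
  ultimately have "of_real (cmod A ^ s * cmod B ^ (q * d)) *
      cis (real s * Arg (cnj A) + real q * real d * Arg B) =
      of_real ((1 - \<alpha>) ^ s * \<alpha> ^ (q * d) / cmod w ^ (2 * (s * q)))" by simp
  then have "cis (real s * Arg (cnj A) + real q * real d * Arg B) = 1"
    by (rule positive_real_of_cis) (use S \<alpha> w in auto)
  then show thesis using that by (auto simp: A_def B_def elim: cis_eq_1_imp_multiple)
qed

lemma phi_cnj: "phi q s d \<alpha> (cnj w) = cnj (phi q s d \<alpha> w)"
  by (simp add: phi_def power_int_def)

lemma coprime_powers_1:
  fixes w :: complex
  assumes "w ^ q = 1" "w ^ s = 1"
  shows "w = 1"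
proof -
  have "w ^ (q * r) = (w ^ s) ^ p * w"
    unfolding det by (simp add: power_mult[symmetric] mult.commute)
  then show ?thesis using assms by (simp add: power_mult)
qed

text \<open>Both sides are positive reals with sum \<open>1\<close>. That sum is strictly decreasing
  in \<open>cmod w\<close>, hence \<open>cmod w = 1\<close>; then the sides are
  \<open>1 - \<alpha>\<close> and \<open>\<alpha>\<close>, which gives
  \<open>w ^ q = w ^ s = 1\<close>.\<close>

lemma flat_root_eq_1:
  assumes \<alpha>: "0 < \<alpha>" "\<alpha> < 1" and w: "w \<noteq> 0" and root: "phi q s d \<alpha> w = 0"
    and A0: "Arg (cnj (sideA \<alpha> w)) = 0" and B0: "Arg (1 - sideA \<alpha> w) = 0"
  shows "w = 1"
proof -
  define A where "A = sideA \<alpha> w"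
  define B where "B = 1 - A"
  note S = sides_of_root[OF \<alpha> w root, folded A_def, folded B_def]
  have "cnj A = of_real (cmod A)" "B = of_real (cmod B)"
    using rcis_cmod_Arg[of "cnj A"] rcis_cmod_Arg[of B] A0 B0 by (simp_all add: A_def B_def rcis_def)
  then have A: "A = of_real (cmod A)" and B: "B = of_real (cmod B)"
    by (metis complex_cnj_cnj complex_cnj_complex_of_real)+
  have k: "0 < real s / real d" using qs qd_bounds by simp
  have "of_real (cmod A + cmod B) = (1 :: complex)" using A B by (simp add: B_def)
  then have sum: "(1 - \<alpha>) / cmod w ^ q + \<alpha> / cmod w powr (real s / real d) = 1"
    unfolding S(4,5) by (metis of_real_eq_1_iff)
  have "cmod w = 1"
  proof (rule ccontr)
    assume "cmod w \<noteq> 1"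
    then consider "cmod w < 1" | "1 < cmod w" by linarith
    then show False
    proof cases
      case 1
      then have "cmod w ^ q < 1" "cmod w powr (real s / real d) < 1"
        using w k q2 powr_less_mono2[OF k, of "cmod w" 1] by (simp_all add: power_less_one_iff)
      then have "1 - \<alpha> < (1 - \<alpha>) / cmod w ^ q" "\<alpha> < \<alpha> / cmod w powr (real s / real d)"
        using \<alpha> w by (simp_all add: less_divide_eq)
      then show False using sum by linarith
    next
      case 2
      then have "1 < cmod w ^ q" "1 < cmod w powr (real s / real d)"
        using w k q2 powr_less_mono2[OF k, of 1 "cmod w"] by (simp_all add: one_less_power)
      then have "(1 - \<alpha>) / cmod w ^ q < 1 - \<alpha>" "\<alpha> / cmod w powr (real s / real d) < \<alpha>"
        using \<alpha> w by (simp_all add: divide_less_eq)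
      then show False using sum by linarith
    qed
  qed
  then have "A = of_real (1 - \<alpha>)" "B = of_real \<alpha>" using A B S(4,5) by simp_all
  then have "w ^ q = 1" "w ^ s = 1"
    using S(3) \<alpha> w by (simp_all add: A_def sideA_def divide_eq_eq)
  then show ?thesis by (rule coprime_powers_1)
qed

text \<open>The values \<open>0\<close> and \<open>1\<close> of \<open>\<alpha>\<close> would give
  \<open>t ^ q = 1\<close> and \<open>t ^ s = 1\<close>, but inside the arc neither power is real
  and positive.\<close>

lemma root_on_ray_alpha:
  assumes xy: "0 < xang \<theta>" "0 < yang \<theta>" and \<rho>: "0 < \<rho>" and \<alpha>: "0 \<le> \<alpha>" "\<alpha> \<le> 1"
    and root: "phi q s d \<alpha> (of_real \<rho> * cis \<theta>) = 0"
  shows "0 < \<alpha>" "\<alpha> < 1"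
proof -
  define t where "t = of_real \<rho> * cis \<theta>"
  have t: "t \<noteq> 0" using \<rho> by (simp add: t_def)
  have d: "0 < d" using qd_bounds by simp
  have eq: "(1 - of_real (1 - \<alpha>) / t ^ q) ^ d * t ^ s = of_real \<alpha> ^ d"
    using root t by (simp add: phi_root_iff t_def)
  have "\<alpha> \<noteq> 0"
  proof
    assume "\<alpha> = 0"
    then have "t ^ q = 1" using eq t d by (simp add: power_0_left)
    then show False using ray_neq_1(1)[OF xy \<rho>] by (simp add: t_def)
  qed
  moreover have "\<alpha> \<noteq> 1"
  proof
    assume "\<alpha> = 1"
    then have "t ^ s = 1" using eq by simp
    then have "cis (yang \<theta>) * t ^ s = cis (yang \<theta>)" by simp
    then have "of_real (\<rho> ^ s) * (cis (yang \<theta>) * cis \<theta> ^ s) = cis (yang \<theta>)"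
      by (simp add: t_def power_mult_distrib mult_ac)
    then have "of_real (\<rho> ^ s) = cis (yang \<theta>)" unfolding cis_yang by simp
    then have "sin (yang \<theta>) = 0" by (metis Im_complex_of_real cis.sel(2))
    moreover have "0 < sin (yang \<theta>)" using xy angle_bounds[OF xy] by (intro sin_gt_zero) auto
    ultimately show False by simp
  qed
  ultimately show "0 < \<alpha>" "\<alpha> < 1" using \<alpha> by auto
qed

text \<open>The root equation fixes \<open>real d * Y\<close> only modulo \<open>2 * pi\<close>.
  Values above \<open>yang \<theta>\<close> would make \<open>t\<close> interior, and values below
  are excluded by \<open>0 < Y\<close> and \<open>yang \<theta> < pi\<close>.\<close>

lemma exterior_root_principal:
  assumes xy: "0 < xang \<theta>" "0 < yang \<theta>" and \<rho>: "0 < \<rho>" and \<alpha>: "0 < \<alpha>" "\<alpha> < 1"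
    and t_def: "t = of_real \<rho> * cis \<theta>"
    and root: "phi q s d \<alpha> t = 0" and ext: "t \<notin> interior (Theta n)"
  shows "unit_triangle (cmod (sideA \<alpha> t)) (cmod (1 - sideA \<alpha> t)) (xang \<theta>) (yang \<theta> / real d)"
proof -
  define A where "A = sideA \<alpha> t"
  define B where "B = 1 - A"
  define Y where "Y = Arg B"
  define k where "k = real s / real d"
  have t: "t \<noteq> 0" "cmod t = \<rho>" using \<rho> by (simp_all add: t_def norm_mult)
  have d: "0 < d" using qd_bounds by simp
  note S = sides_of_root[OF \<alpha> t(1) root, folded A_def, folded B_def]
  have a: "cmod A = (1 - \<alpha>) / \<rho> ^ q" and b: "cmod B = \<alpha> / \<rho> powr k"
    using S(4,5) by (simp_all add: t(2) k_def)
  have sx: "0 < sin (xang \<theta>)" using xy angle_bounds[OF xy] by (intro sin_gt_zero) auto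
  have tq: "t ^ q = of_real (\<rho> ^ q) * cis (xang \<theta>)"
    by (simp add: t_def power_mult_distrib cis_xang)
  have cA: "cnj A = of_real ((1 - \<alpha>) / \<rho> ^ q) * cis (xang \<theta>)"
    unfolding A_def sideA_def tq by (simp add: cis_cnj divide_simps cis_mult)
  have c: "0 < (1 - \<alpha>) / \<rho> ^ q" using \<alpha> \<rho> by simp
  have ArgA: "Arg (cnj A) = xang \<theta>"
    unfolding cA using c xy angle_bounds[OF xy] by (subst Arg_times_of_real) (auto intro!: Arg_cis)
  have "Im B = Im (cnj A)" by (simp add: B_def)
  also have "\<dots> = (1 - \<alpha>) / \<rho> ^ q * sin (xang \<theta>)" unfolding cA by simp
  finally have ImB: "0 < Im B" using mult_pos_pos[OF c sx] by argo
  have tri: "unit_triangle (cmod A) (cmod B) (xang \<theta>) Y"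
    using unit_triangle_Arg[of A B] S(1,2) ImB ArgA by (simp add: Y_def B_def)
  have Y0: "0 < Y"
    using ImB Arg_lt_pi[of B] by (simp add: Y_def)
  from tri have P: "xang \<theta> + Y < pi" "cmod A = sin Y / sin (xang \<theta> + Y)"
      "cmod B = sin (xang \<theta>) / sin (xang \<theta> + Y)"
    using xy Y0 by (auto elim: unit_triangle_cases)
  have S0: "0 < sin (xang \<theta> + Y)" using xy Y0 P by (intro sin_gt_zero) auto
  have sum: "\<rho> ^ q * cmod A + \<rho> powr k * cmod B = 1"
    unfolding a b using \<rho> by simp
  have eq: "\<rho> ^ q * sin Y + \<rho> powr k * sin (xang \<theta>) = sin (xang \<theta> + Y)"
    using sum S0 unfolding P(2,3) by (simp add: field_simps)
  \<comment> \<open>For \<open>\<rho> \<ge> 1\<close> the two sides would add up to at most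
    \<open>1\<close>, while their projections add up to \<open>1\<close> and the first one is
    strictly shorter than its side.\<close>
  have \<rho>1: "\<rho> < 1"
  proof (rule ccontr)
    assume "\<not> \<rho> < 1"
    then have "1 \<le> \<rho> ^ q" "1 \<le> \<rho> powr k"
      by (simp_all add: one_le_power ge_one_powr_ge_zero k_def)
    then have "cmod A * 1 \<le> cmod A * \<rho> ^ q" "cmod B * 1 \<le> cmod B * \<rho> powr k"
      using mult_left_mono[OF _ norm_ge_zero] by blast+
    then have "cmod A + cmod B \<le> 1" using sum by (simp add: mult.commute)
    moreover have "cmod A * cos (xang \<theta>) + cmod B * cos Y = 1"
      using tri by (simp add: unit_triangle_def)
    moreover have "cmod B * cos Y \<le> cmod B" by (simp add: mult_left_le)
    moreover have "cmod A * cos (xang \<theta>) < cmod A * 1"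
    proof (rule mult_strict_left_mono)
      show "cos (xang \<theta>) < 1"
        using cos_monotone_0_pi[of 0 "xang \<theta>"] xy angle_bounds[OF xy] by simp
    qed (use S(1) in simp)
    ultimately show False by simp
  qed
  have "B ^ d = of_real (cmod B ^ d) * cis (real d * Y)"
    using arg_cong[OF rcis_cmod_Arg[of B], of "\<lambda>z. z ^ d"]
    by (simp add: rcis_def power_mult_distrib Complex.DeMoivre Y_def)
  then have "of_real (cmod B ^ d * \<rho> ^ s) * cis (real d * Y + real s * \<theta>) = of_real (\<alpha> ^ d)"
    using S(3) by (simp add: t_def power_mult_distrib Complex.DeMoivre cis_mult[symmetric] mult_ac)
  then have "cis (real d * Y + real s * \<theta>) = 1"
    by (rule positive_real_of_cis) (use S(2) \<alpha> \<rho> in auto)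
  then obtain j :: int where "real d * Y + real s * \<theta> = 2 * pi * of_int j"
    by (elim cis_eq_1_imp_multiple)
  then have j: "real d * Y - yang \<theta> = 2 * pi * of_int (j - int r)"
    by (simp add: yang_def algebra_simps)
  have "Y \<le> yang \<theta> / real d"
    using nonprincipal_interior[OF xy \<rho> \<rho>1 _ P(1)] eq ext
    by (auto simp: t_def k_def not_less[symmetric])
  then have "real d * Y - yang \<theta> \<le> 0" using d by (simp add: field_simps)
  then have "j - int r \<le> 0" unfolding j using pi_gt_zero by (simp add: mult_le_0_iff)
  moreover have "- 1 < j - int r"
  proof -
    have "0 < real d * Y" using d Y0 by simp
    then have "2 * pi * (- 1) < 2 * pi * of_int (j - int r)"
      using j angle_bounds(4)[OF xy] pi_gt_zero by linarith
    then have "- 1 < real_of_int (j - int r)"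
      using pi_gt_zero by (subst (asm) mult_less_cancel_left_pos) auto
    then show ?thesis by linarith
  qed
  ultimately have "j - int r = 0" by simp
  then have "Y = yang \<theta> / real d" using j d by (simp add: field_simps)
  then show ?thesis using tri by (simp add: A_def B_def)
qed

lemma root_modulus_le:
  assumes xy: "0 < xang \<theta>" "0 < yang \<theta>" and \<rho>: "0 < \<rho>" and \<alpha>: "0 \<le> \<alpha>" "\<alpha> \<le> 1"
    and t_def: "t = of_real \<rho> * cis \<theta>"
    and root: "phi q s d \<alpha> t = 0" and ext: "t \<notin> interior (Theta n)"
    and w: "w \<noteq> 1" "phi q s d \<alpha> w = 0"
  shows "cmod w \<le> cmod t"
proof -
  have \<alpha>': "0 < \<alpha>" "\<alpha> < 1"
    using root_on_ray_alpha[OF xy \<rho> \<alpha>] root by (simp_all add: t_def)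
  have d: "0 < real d" using qd_bounds by simp
  have t: "t \<noteq> 0" "cmod t = \<rho>" using \<rho> by (simp_all add: t_def norm_mult)
  have upper: "cmod w \<le> cmod t"
    if w: "w \<noteq> 1" "phi q s d \<alpha> w = 0" and Im: "0 \<le> Im (1 - sideA \<alpha> w)" for w
  proof (rule ccontr)
    assume "\<not> ?thesis"
    then have gt: "\<rho> < cmod w" using t by simp
    then have w0: "w \<noteq> 0" using \<rho> by auto
    define X Y where "X = Arg (cnj (sideA \<alpha> w))" and "Y = Arg (1 - sideA \<alpha> w)"
    define a b where "a = cmod (sideA \<alpha> w)" and "b = cmod (1 - sideA \<alpha> w)"
    define a0 b0 where "a0 = cmod (sideA \<alpha> t)" and "b0 = cmod (1 - sideA \<alpha> t)"
    define L where "L = ln (cmod w) - ln \<rho>"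
    have L: "0 < L" using ln_less_cancel_iff[of \<rho> "cmod w"] gt \<rho> unfolding L_def by linarith
    note Sw = sides_of_root[OF \<alpha>' w0 w(2)] and St = sides_of_root[OF \<alpha>' t(1) root]
    have tri: "unit_triangle a b X Y"
      unfolding a_def b_def X_def Y_def using Sw Im by (intro unit_triangle_Arg) auto
    have tri0: "unit_triangle a0 b0 (xang \<theta>) (yang \<theta> / real d)"
      unfolding a0_def b0_def by (rule exterior_root_principal[OF xy \<rho> \<alpha>' t_def root ext])
    have XY: "X \<noteq> 0 \<or> Y \<noteq> 0"
      using flat_root_eq_1[OF \<alpha>' w0 w(2)] w(1) by (auto simp: X_def Y_def)
    \<comment> \<open>Passing from \<open>t\<close> to \<open>w\<close> changes the logarithms of
      the sides in the fixed ratio of \<open>q\<close> to \<open>s / d\<close>, so the monotonicity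
      pairing becomes a negative multiple of the difference of the angle sums
      \<open>2 * pi * m\<close>.\<close>
    have la: "ln a - ln a0 = - real q * L"
      using \<alpha>' w0 \<rho> unfolding a_def a0_def Sw(4) St(4) t(2)
      by (simp add: ln_div ln_realpow L_def algebra_simps)
    have lb: "ln b - ln b0 = - (real s / real d) * L"
      using \<alpha>' w0 \<rho> unfolding b_def b0_def Sw(5) St(5) t(2)
      by (simp add: ln_div ln_powr L_def algebra_simps)
    have ne: "a \<noteq> a0" using la L q2 by auto
    have "0 < (X - xang \<theta>) * (ln b - ln b0) + (Y - yang \<theta> / real d) * (ln a - ln a0)"
      using unit_triangle_monotone[OF tri0 xy(1) _ tri XY ne] xy d by simp
    also have "\<dots> = - (L / real d) * ((real s * X + real q * real d * Y) -
        (real s * xang \<theta> + real q * yang \<theta>))"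
      unfolding la lb using d by (simp add: field_simps)
    finally have "real s * X + real q * real d * Y < 2 * pi"
      unfolding angle_sum using L d by (simp add: mult_less_0_iff divide_less_0_iff)
    moreover obtain m :: int where m: "real s * X + real q * real d * Y = 2 * pi * of_int m"
      using root_angles_quantized[OF \<alpha>' w0 w(2)] by (auto simp: X_def Y_def)
    ultimately have "2 * pi * of_int m < 2 * pi * 1" by simp
    then have "real_of_int m < 1" using pi_gt_zero by (subst (asm) mult_less_cancel_left_pos) auto
    \<comment> \<open>Nonnegative angles with a nonpositive weighted sum both vanish, which
      \<open>XY\<close> forbids.\<close>
    then have "m \<le> 0" by linarith
    then have "real s * X + real q * real d * Y \<le> 0" unfolding m by (simp add: mult_le_0_iff)
    moreover have "0 \<le> X" "0 \<le> Y" using tri by (auto simp: unit_triangle_def)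
    moreover have "0 < real s" "0 < real q * real d" using qs q2 d by auto
    ultimately show False
      using XY by (smt (verit) mult_nonneg_nonneg mult_pos_pos)
  qed
  show ?thesis
  proof (cases "0 \<le> Im (1 - sideA \<alpha> w)")
    case True
    then show ?thesis using upper w by blast
  next
    case False
    have "sideA \<alpha> (cnj w) = cnj (sideA \<alpha> w)" by (simp add: sideA_def)
    then have "0 \<le> Im (1 - sideA \<alpha> (cnj w))" using False by simp
    moreover have "cnj w \<noteq> 1" "phi q s d \<alpha> (cnj w) = 0" using w by (simp_all add: phi_cnj)
    ultimately show ?thesis using upper[of "cnj w"] by simp
  qed
qed

lemma subdominant_on_upper_arc:
  assumes "0 < xang \<theta>" "0 < yang \<theta>" "0 < \<rho>" "0 \<le> \<alpha>" "\<alpha> \<le> 1" "t = of_real \<rho> * cis \<theta>"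
    "phi q s d \<alpha> t = 0" "t \<notin> interior (Theta n)"
  shows "subdominant_root (phi q s d \<alpha>) t"
  using root_modulus_le[OF assms] ray_neq_1(2)[OF assms(1-3)] assms(6,7)
  by (auto simp: subdominant_root_def)

lemma subdominant_root_cnj:
  assumes "subdominant_root (phi q s d \<alpha>) (cnj t)"
  shows "subdominant_root (phi q s d \<alpha>) t"
  using assms by (auto simp: subdominant_root_def phi_cnj)

end

section \<open>Conjugation symmetry and the lower arc\<close>

lemma cnj_in_Theta:
  assumes "z \<in> Theta n"
  shows "cnj z \<in> Theta n"
proof -
  obtain A v where A: "stochastic n A" "\<exists>i<n. v i \<noteq> 0"
    and ev: "\<And>i. i < n \<Longrightarrow> (\<Sum>j<n. complex_of_real (A i j) * v j) = z * v i"
    using assms by (auto simp: Theta_def is_eigenvalue_def)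
  have "(\<Sum>j<n. complex_of_real (A i j) * cnj (v j)) = cnj z * cnj (v i)" if "i < n" for i
    using arg_cong[OF ev[OF that], of cnj] by simp
  then have "is_eigenvalue n A (cnj z)"
    using A(2) unfolding is_eigenvalue_def by (intro exI[of _ "\<lambda>i. cnj (v i)"]) auto
  then show ?thesis using A(1) by (auto simp: Theta_def)
qed

lemma cnj_in_interior_Theta:
  assumes "cnj z \<in> interior (Theta n)"
  shows "z \<in> interior (Theta n)"
proof -
  obtain U where U: "open U" "cnj z \<in> U" "U \<subseteq> Theta n"
    using assms by (auto simp: interior_def)
  have "open (cnj -` U)" using U(1) by (intro open_vimage continuous_on_cnj continuous_on_id)
  moreover have "cnj -` U \<subseteq> Theta n"
    using U(3) cnj_in_Theta by (metis complex_cnj_cnj subsetD subsetI vimageE)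
  ultimately show ?thesis using U(2) by (auto intro: interiorI)
qed

theorem theorem5p5:
  fixes n p q r s :: nat and \<theta> \<rho> \<alpha> :: real and t :: complex
  assumes "farey_pair n p q r s"
    and "0 < p" and "r < s"
    and "q < s"
    and "\<theta> \<in> arg_set p q r s"
    and "t \<in> frontier (Theta n)"
    and "0 < \<rho>" and "t = complex_of_real \<rho> * cis \<theta>"
    and "0 \<le> \<alpha>" and "\<alpha> \<le> 1"
    and "phi q s (n div q) \<alpha> t = 0"
  shows "subdominant_root (phi q s (n div q) \<alpha>) t"
proof -
  have pq: "p < q" "s \<le> n" using assms(1) by (auto simp: farey_pair_def farey_def)
  interpret farey_arc n p q r s "n div q"
    using farey_pair_consecutive[OF assms(1)] assms(2,4) pq by unfold_locales auto
  have ext: "t \<notin> interior (Theta n)" using assms(6) by (simp add: frontier_def)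
  have q: "0 < real q" "0 < real s" using pq assms(4) by auto
  consider "2 * pi * real p / real q < \<theta>" "\<theta> < 2 * pi * real r / real s"
    | "2 * pi * (real s - real r) / real s < \<theta>" "\<theta> < 2 * pi * (real q - real p) / real q"
    using assms(5) by (auto simp: arg_set_def)
  then show ?thesis
  proof cases
    case 1
    then have "0 < xang \<theta>" "0 < yang \<theta>"
      using q by (simp_all add: xang_def yang_def field_simps)
    then show ?thesis using subdominant_on_upper_arc assms ext by blast
  next
    \<comment> \<open>Conjugation replaces \<open>\<theta>\<close> by
      \<open>2 * pi - \<theta>\<close> and carries the second interval onto the first.\<close>
    case 2
    then have "0 < xang (2 * pi - \<theta>)" "0 < yang (2 * pi - \<theta>)"
      using q by (simp_all add: xang_def yang_def field_simps)
    moreover have "cnj t = of_real \<rho> * cis (2 * pi - \<theta>)"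
      using assms(8) by (simp add: complex_eq_iff cos_diff sin_diff)
    moreover have "phi q s (n div q) \<alpha> (cnj t) = 0" using assms(11) by (simp add: phi_cnj)
    moreover have "cnj t \<notin> interior (Theta n)" using ext cnj_in_interior_Theta by blast
    ultimately show ?thesis
      using subdominant_on_upper_arc assms(7,9,10) subdominant_root_cnj by blast
  qed
qed

end
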